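(* Let $G$ be a group with finite generating set $S$ and let $Q$ be a subgroup of $G$. Then $Q$ is quasi-normal in $G$ if and only if the left coset graph $\Lambda(S,Q,G)$ is locally finite.
   Context: For a subgroup $H$ of a group $G$, the commensurator of $H$ in $G$ is $Comm(H,G)=\{g\in G : gHg^{-1}\cap H \text{ has finite index in both } H \text{ and } gHg^{-1}\}$. A subgroup $Q$ of $G$ is quasi-normal in $G$ if $Comm(Q,G)=G$. $\Lambda(S,Q,G)$ is the graph whose vertices are the left cosets $gQ$, with a directed edge labeled $s\in S$ from $gQ$ to $fQ$ whenever $gq_1sq_2=f$ for some $q_1,q_2\in Q$ (equivalently, in the Cayley graph of $G$ with respect to $S$ there is an edge labeled $s$ with initial point in $gQ$ and end point in $fQ$). For a given $s$ there is at most one edge labeled $s$ from a given vertex to another given vertex. A graph is locally finite if each vertex has finite valence. *)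

theory Defs
  imports "HOL-Algebra.Algebra" "Graph_Theory.Digraph"
begin

definition conj_subgroup :: "('a, 'b) monoid_scheme \<Rightarrow> 'a \<Rightarrow> 'a set \<Rightarrow> 'a set" where
  "conj_subgroup G g H = (g <#\<^bsub>G\<^esub> H) #>\<^bsub>G\<^esub> (inv\<^bsub>G\<^esub> g)"

text \<open>The index of a subgroup \<open>K \<le> H\<close> is the number of its cosets in \<open>H\<close>. Finiteness is
  expressed on the set of cosets because \<^const>\<open>card\<close> does not detect infinite index.\<close>

definition finite_index :: "('a, 'b) monoid_scheme \<Rightarrow> 'a set \<Rightarrow> 'a set \<Rightarrow> bool" where
  "finite_index G K H \<longleftrightarrow> finite (rcosets\<^bsub>G\<lparr>carrier := H\<rparr>\<^esub> K)"

definition commensurator :: "('a, 'b) monoid_scheme \<Rightarrow> 'a set \<Rightarrow> 'a set" where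
  "commensurator G H =
    {g \<in> carrier G. finite_index G (conj_subgroup G g H \<inter> H) H \<and>
                    finite_index G (conj_subgroup G g H \<inter> H) (conj_subgroup G g H)}"

definition quasi_normal :: "('a, 'b) monoid_scheme \<Rightarrow> 'a set \<Rightarrow> bool" where
  "quasi_normal G Q \<longleftrightarrow> commensurator G Q = carrier G"

text \<open>An arc is the triple of its initial vertex, its label and its end vertex, so that arcs
  between the same two vertices are distinguished exactly by their labels.\<close>

definition left_coset_graph ::
    "('a, 'b) monoid_scheme \<Rightarrow> 'a set \<Rightarrow> 'a set \<Rightarrow> ('a set, 'a set \<times> 'a \<times> 'a set) pre_digraph" where
  "left_coset_graph G S Q =
    \<lparr>verts = lcosets\<^bsub>G\<^esub> Q,
     arcs = {(g <#\<^bsub>G\<^esub> Q, s, f <#\<^bsub>G\<^esub> Q) | g s f. g \<in> carrier G \<and> s \<in> S \<and> f \<in> carrier G \<and>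
              (\<exists>q1\<in>Q. \<exists>q2\<in>Q. g \<otimes>\<^bsub>G\<^esub> q1 \<otimes>\<^bsub>G\<^esub> s \<otimes>\<^bsub>G\<^esub> q2 = f)},
     tail = (\<lambda>(u, s, v). u),
     head = (\<lambda>(u, s, v). v)\<rparr>"

text \<open>The valence of a vertex counts the arcs starting there together with those ending there.\<close>

definition locally_finite :: "('v, 'e) pre_digraph \<Rightarrow> bool" where
  "locally_finite \<Gamma> \<longleftrightarrow> (\<forall>v\<in>verts \<Gamma>. finite (out_arcs \<Gamma> v) \<and> finite (in_arcs \<Gamma> v))"

lemma wf_digraph_left_coset_graph: "wf_digraph (left_coset_graph G S Q)"
  by unfold_locales (auto simp: left_coset_graph_def LCOSETS_def)

text \<open>The equivalent description of the arcs through the edges \<open>a \<rightarrow> a s\<close> of the Cayley graph.\<close>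

lemma arcs_left_coset_graph_iff:
  assumes "group G" "S \<subseteq> carrier G" "subgroup Q G"
  shows "(u, s, v) \<in> arcs (left_coset_graph G S Q) \<longleftrightarrow>
    u \<in> lcosets\<^bsub>G\<^esub> Q \<and> v \<in> lcosets\<^bsub>G\<^esub> Q \<and> s \<in> S \<and> (\<exists>a\<in>u. a \<otimes>\<^bsub>G\<^esub> s \<in> v)"
    (is "?L \<longleftrightarrow> ?R")
proof -
  interpret group G by fact
  interpret Q: subgroup Q G by fact
  show ?thesis
  proof
    assume ?L
    then obtain g f q1 q2 where *: "u = g <#\<^bsub>G\<^esub> Q" "v = f <#\<^bsub>G\<^esub> Q" "g \<in> carrier G" "s \<in> S"
      "f \<in> carrier G" "q1 \<in> Q" "q2 \<in> Q" "g \<otimes>\<^bsub>G\<^esub> q1 \<otimes>\<^bsub>G\<^esub> s \<otimes>\<^bsub>G\<^esub> q2 = f"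
      by (auto simp: left_coset_graph_def)
    have s: "s \<in> carrier G" using * assms by auto
    have q: "q1 \<in> carrier G" "q2 \<in> carrier G" using * by auto
    have "g \<otimes>\<^bsub>G\<^esub> q1 \<otimes>\<^bsub>G\<^esub> s = f \<otimes>\<^bsub>G\<^esub> inv\<^bsub>G\<^esub> q2"
      using * s q by (metis inv_solve_right m_closed)
    then have "g \<otimes>\<^bsub>G\<^esub> q1 \<in> u \<and> g \<otimes>\<^bsub>G\<^esub> q1 \<otimes>\<^bsub>G\<^esub> s \<in> v"
      using * Q.m_inv_closed[of q2] by (auto simp: l_coset_def)
    then show ?R using * by (auto simp: LCOSETS_def)
  next
    assume ?R
    then obtain g f q1 q2 where *: "u = g <#\<^bsub>G\<^esub> Q" "v = f <#\<^bsub>G\<^esub> Q" "g \<in> carrier G" "s \<in> S"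
      "f \<in> carrier G" "q1 \<in> Q" "q2 \<in> Q" "g \<otimes>\<^bsub>G\<^esub> q1 \<otimes>\<^bsub>G\<^esub> s = f \<otimes>\<^bsub>G\<^esub> q2"
      by (auto simp: LCOSETS_def l_coset_def)
    have q: "q1 \<in> carrier G" "q2 \<in> carrier G" using * by auto
    have "g \<otimes>\<^bsub>G\<^esub> q1 \<otimes>\<^bsub>G\<^esub> s \<otimes>\<^bsub>G\<^esub> inv\<^bsub>G\<^esub> q2 = f"
      using * q by (simp add: m_assoc)
    then show ?L using * Q.m_inv_closed[of q2]
      unfolding left_coset_graph_def pre_digraph.simps by blast
  qed
qed

end

theory Submission
  imports Defs
begin

no_notation subset_mset (infix \<open><#\<close> 50)

text \<open>The finiteness of the set of left cosets of \<open>Q\<close> contained in a double coset \<open>Q a Q\<close> links the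
  two sides. By the orbit-stabilizer principle it says that \<open>Q \<inter> a Q a\<inverse>\<close> has finite index in \<open>Q\<close>;
  conjugating by \<open>a\<close>, the same condition for \<open>a\<inverse>\<close> says that the index in \<open>a Q a\<inverse>\<close> is finite.
  On the other hand the arcs labeled \<open>s\<close> leaving \<open>Q\<close> correspond to the left cosets in \<open>Q s Q\<close> and
  those entering \<open>Q\<close> to the left cosets in \<open>Q s\<inverse> Q\<close>, and \<open>G\<close> acts transitively on the vertices.
  Since \<open>Q a b Q \<subseteq> Q a Q b Q\<close>, the condition passes from the generators and their inverses to all
  of \<open>G\<close>.\<close>

section \<open>Finiteness of images under two maps\<close>

lemma finite_image_factor:
  assumes "\<And>x y. x \<in> A \<Longrightarrow> y \<in> A \<Longrightarrow> g x = g y \<Longrightarrow> f x = f y" and "finite (g ` A)"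
  shows "finite (f ` A)"
proof -
  \<comment> \<open>On \<open>A\<close> the value of \<open>f\<close> depends only on that of
    \<open>g\<close>, so it can be computed at the preimage chosen by
    \<open>inv_into\<close>.\<close>
  have "f ` A = (\<lambda>z. f (inv_into A g z)) ` g ` A"
    unfolding image_image
    by (intro image_cong refl assms(1)) (auto simp: inv_into_into f_inv_into_f)
  then show ?thesis using assms(2) by simp
qed

text \<open>Two maps with the same fibres have images in bijection. Families of cosets can thus be
  compared through their equality criteria alone.\<close>

lemma finite_image_cong_iff:
  assumes "\<And>x y. x \<in> A \<Longrightarrow> y \<in> A \<Longrightarrow> f x = f y \<longleftrightarrow> g x = g y"
  shows "finite (f ` A) \<longleftrightarrow> finite (g ` A)"
  using finite_image_factor[of A g f] finite_image_factor[of A f g] assms by blast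

lemma tail_left_coset_graph: "tail (left_coset_graph G S Q) = (\<lambda>(u, s, v). u)"
  by (simp add: left_coset_graph_def)

lemma head_left_coset_graph: "head (left_coset_graph G S Q) = (\<lambda>(u, s, v). v)"
  by (simp add: left_coset_graph_def)

text \<open>For a subgroup \<open>Q\<close> this is the orbit of \<open>a <# Q\<close> under left
  multiplication by \<open>Q\<close>.\<close>

definition double_coset_lcosets :: "('a, 'b) monoid_scheme \<Rightarrow> 'a set \<Rightarrow> 'a \<Rightarrow> 'a set set" where
  "double_coset_lcosets G Q a = (\<lambda>q. (q \<otimes>\<^bsub>G\<^esub> a) <#\<^bsub>G\<^esub> Q) ` Q"

context group
begin

section \<open>Equality and translation of cosets\<close>

lemma r_coset_eq_iff:
  assumes "subgroup H G" "x \<in> carrier G" "y \<in> carrier G"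
  shows "H #> x = H #> y \<longleftrightarrow> x \<otimes> inv y \<in> H"
  using assms by (metis group_axioms rcos_self repr_independence subgroup.rcos_module)

lemma l_coset_eq_iff:
  assumes "subgroup H G" "x \<in> carrier G" "y \<in> carrier G"
  shows "x <# H = y <# H \<longleftrightarrow> inv x \<otimes> y \<in> H"
proof
  assume "x <# H = y <# H"
  then have "y \<in> x <# H" using assms lcos_self by blast
  then show "inv x \<otimes> y \<in> H"
    using assms subgroup.mem_carrier[OF assms(1)] by (auto simp: l_coset_def m_assoc[symmetric])
next
  assume "inv x \<otimes> y \<in> H"
  moreover have "y = x \<otimes> (inv x \<otimes> y)" using assms by (simp add: m_assoc[symmetric])
  ultimately have "y \<in> x <# H" by (auto simp: l_coset_def)
  then show "x <# H = y <# H" using assms l_repr_independence by blast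
qed

text \<open>Left cosets partition the group. This turns the condition that a Cayley edge has an
  endpoint in a vertex into an equation for that vertex.\<close>

lemma lcosets_mem_iff:
  assumes "subgroup H G" "x \<in> carrier G"
  shows "C \<in> lcosets H \<and> x \<in> C \<longleftrightarrow> C = x <# H"
proof
  assume "C \<in> lcosets H \<and> x \<in> C"
  then obtain a where "a \<in> carrier G" "C = a <# H" "x \<in> a <# H" by (auto simp: LCOSETS_def)
  then show "C = x <# H" using assms l_repr_independence by blast
next
  assume "C = x <# H"
  then show "C \<in> lcosets H \<and> x \<in> C" using assms lcos_self by (auto simp: LCOSETS_def)
qed

text \<open>Translation by \<open>inv g\<close> is a left inverse. It lets finiteness be carried
  from one vertex to another.\<close>

lemma inj_on_l_coset:
  assumes "g \<in> carrier G"
  shows "inj_on (\<lambda>A. g <# A) (Pow (carrier G))"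
  by (rule inj_on_inverseI[where g = "\<lambda>A. inv g <# A"])
    (use assms in \<open>auto simp: lcos_m_assoc lcos_mult_one\<close>)

lemma double_coset_lcosets_subset:
  assumes "subgroup Q G" "a \<in> carrier G"
  shows "double_coset_lcosets G Q a \<subseteq> Pow (carrier G)"
proof -
  have "(q \<otimes> a) <# Q \<subseteq> carrier G" if "q \<in> Q" for q
    using assms that by (meson l_coset_subset_G m_closed subgroup.mem_carrier subgroup.subset)
  then show ?thesis by (auto simp: double_coset_lcosets_def)
qed

section \<open>Finite index and double cosets\<close>

text \<open>Orbit-stabilizer: \<open>H\<close> acts by left multiplication on the left cosets of
  \<open>L\<close>, and the stabilizer of \<open>L\<close> itself is
  \<open>H \<inter> L\<close>.\<close>

lemma finite_index_Int_iff:
  assumes H: "subgroup H G" and L: "subgroup L G"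
  shows "finite_index G (H \<inter> L) H \<longleftrightarrow> finite ((\<lambda>h. h <# L) ` H)"
proof -
  have HL: "subgroup (H \<inter> L) G" using assms subgroups_Inter_pair by blast
  have "rcosets\<^bsub>G\<lparr>carrier := H\<rparr>\<^esub> (H \<inter> L) = (\<lambda>h. H \<inter> L #> h) ` H"
    by (auto simp: RCOSETS_def r_coset_def)
  \<comment> \<open>Inversion permutes \<open>H\<close> and exchanges right with left cosets, so
    that equality in both families is decided by \<open>inv x \<otimes> y\<close>.\<close>
  also have "\<dots> = (\<lambda>h. H \<inter> L #> inv h) ` H"
  proof -
    have "m_inv G ` H = H"
    proof
      show "m_inv G ` H \<subseteq> H" using H by (auto simp: subgroup.m_inv_closed)
      show "H \<subseteq> m_inv G ` H"
        using H by (metis image_eqI inv_inv subgroup.m_inv_closed subgroup.mem_carrier subsetI)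
    qed
    then show ?thesis using image_image[of "\<lambda>h. H \<inter> L #> h" "m_inv G" H] by simp
  qed
  also have "finite \<dots> \<longleftrightarrow> finite ((\<lambda>h. h <# L) ` H)"
  proof (rule finite_image_cong_iff)
    fix x y assume xy: "x \<in> H" "y \<in> H"
    then have "x \<in> carrier G" "y \<in> carrier G" by (simp_all add: subgroup.mem_carrier[OF H])
    moreover have "inv x \<otimes> y \<in> H" using xy H by (simp add: subgroup.m_closed subgroup.m_inv_closed)
    ultimately show "H \<inter> L #> inv x = H \<inter> L #> inv y \<longleftrightarrow> x <# L = y <# L"
      using HL L by (simp add: r_coset_eq_iff l_coset_eq_iff)
  qed
  finally show ?thesis unfolding finite_index_def .
qed

text \<open>Finitely many \<open>r\<close> in \<open>Q\<close> represent all cosets in Q a Q, and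
  every coset in Q a b Q is the translate by some \<open>r \<otimes> a\<close> of a coset in Q b
  Q.\<close>

lemma finite_double_coset_mult:
  assumes Q: "subgroup Q G" and a: "a \<in> carrier G" and b: "b \<in> carrier G"
    and fa: "finite (double_coset_lcosets G Q a)" and fb: "finite (double_coset_lcosets G Q b)"
  shows "finite (double_coset_lcosets G Q (a \<otimes> b))"
proof -
  have "\<exists>R\<subseteq>Q. finite R \<and> double_coset_lcosets G Q a = (\<lambda>q. (q \<otimes> a) <# Q) ` R"
    by (rule finite_subset_image[OF fa]) (simp add: double_coset_lcosets_def)
  then obtain R where R: "R \<subseteq> Q" "finite R"
      "double_coset_lcosets G Q a = (\<lambda>q. (q \<otimes> a) <# Q) ` R"
    by blast
  have "double_coset_lcosets G Q (a \<otimes> b) \<subseteq> (\<Union>r\<in>R. (\<lambda>C. (r \<otimes> a) <# C) ` double_coset_lcosets G Q b)"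
  proof
    fix C assume "C \<in> double_coset_lcosets G Q (a \<otimes> b)"
    then obtain q where q: "q \<in> Q" "C = (q \<otimes> (a \<otimes> b)) <# Q" by (auto simp: double_coset_lcosets_def)
    then have "(q \<otimes> a) <# Q \<in> double_coset_lcosets G Q a" by (auto simp: double_coset_lcosets_def)
    then obtain r where r: "r \<in> R" "(q \<otimes> a) <# Q = (r \<otimes> a) <# Q" using R by auto
    have car: "q \<in> carrier G" "r \<in> carrier G" "Q \<subseteq> carrier G"
      using q r R Q subgroup.subset by blast+
    have "q \<otimes> a \<in> (r \<otimes> a) <# Q"
      using lcos_self[of "q \<otimes> a" Q] Q a car unfolding r(2)[symmetric] by simp
    \<comment> \<open>Representatives of the same coset differ by a right factor \<open>p\<close> in
      \<open>Q\<close>, which is then absorbed into the coset of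
      \<open>p \<otimes> b\<close>.\<close>
    then obtain p where p: "p \<in> Q" "q \<otimes> a = r \<otimes> a \<otimes> p" by (auto simp: l_coset_def)
    have "p \<in> carrier G" using p car by auto
    then have "q \<otimes> (a \<otimes> b) = r \<otimes> a \<otimes> (p \<otimes> b)" using p a b car by (metis m_assoc m_closed)
    then have "C = (r \<otimes> a) <# ((p \<otimes> b) <# Q)"
      using q a b car \<open>p \<in> carrier G\<close> by (simp add: lcos_m_assoc)
    then show "C \<in> (\<Union>r\<in>R. (\<lambda>C. (r \<otimes> a) <# C) ` double_coset_lcosets G Q b)"
      using r p by (auto simp: double_coset_lcosets_def)
  qed
  then show ?thesis using R(2) fb by (meson finite_UN_I finite_imageI finite_subset)
qed

text \<open>Induction on words in the generators and their inverses. Inverses enter as a separate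
  assumption since finiteness for \<open>s\<close> does not imply it for
  \<open>inv s\<close>.\<close>

lemma finite_double_coset_generate:
  assumes Q: "subgroup Q G" and S: "S \<subseteq> carrier G"
    and fin: "\<And>s. s \<in> S \<Longrightarrow> finite (double_coset_lcosets G Q s)"
      "\<And>s. s \<in> S \<Longrightarrow> finite (double_coset_lcosets G Q (inv s))"
    and "a \<in> generate G S"
  shows "finite (double_coset_lcosets G Q a)"
  using \<open>a \<in> generate G S\<close>
proof induction
  case one
  have "double_coset_lcosets G Q \<one> \<subseteq> {Q}"
    using Q subgroup.mem_carrier[OF Q] by (auto simp: double_coset_lcosets_def coset_join3)
  then show ?case using finite_subset by blast
next
  case (eng a b)
  then show ?case using S Q by (simp add: finite_double_coset_mult generate_in_carrier)
qed (use fin in auto)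

text \<open>Both parts apply orbit-stabilizer to \<open>Q\<close> and its conjugate, with the roles
  of acting group and point stabilizer exchanged.\<close>

lemma finite_index_conj_subgroup_iff:
  assumes Q: "subgroup Q G" and g: "g \<in> carrier G"
  shows "finite_index G (conj_subgroup G g Q \<inter> Q) Q \<longleftrightarrow> finite (double_coset_lcosets G Q g)"
    and "finite_index G (conj_subgroup G g Q \<inter> Q) (conj_subgroup G g Q) \<longleftrightarrow>
      finite (double_coset_lcosets G Q (inv g))"
proof -
  note Qc = subgroup.mem_carrier[OF Q]
  have sub: "subgroup (conj_subgroup G g Q) G"
    unfolding conj_subgroup_def using assms subgroup_conjugation_is_surj2 by blast
  have conj: "conj_subgroup G g Q = (\<lambda>q. g \<otimes> q \<otimes> inv g) ` Q"
    by (auto simp: conj_subgroup_def l_coset_def r_coset_def)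
  have mem: "x \<in> conj_subgroup G g Q \<longleftrightarrow> inv g \<otimes> x \<otimes> g \<in> Q" if x: "x \<in> carrier G" for x
  proof
    assume "x \<in> conj_subgroup G g Q"
    then obtain q where q: "q \<in> Q" "x = g \<otimes> q \<otimes> inv g" by (auto simp: conj)
    then have "x \<otimes> g = g \<otimes> q" using g Qc by (simp add: m_assoc)
    then show "inv g \<otimes> x \<otimes> g \<in> Q" using q g Qc x by (simp add: m_assoc) (simp add: m_assoc[symmetric])
  next
    assume q: "inv g \<otimes> x \<otimes> g \<in> Q"
    have "x = g \<otimes> (inv g \<otimes> x \<otimes> g) \<otimes> inv g"
      using g x by (simp add: m_assoc) (simp add: m_assoc[symmetric])
    then show "x \<in> conj_subgroup G g Q" using q by (auto simp: conj)
  qed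
  have "finite_index G (conj_subgroup G g Q \<inter> Q) Q \<longleftrightarrow> finite ((\<lambda>h. h <# conj_subgroup G g Q) ` Q)"
    using finite_index_Int_iff[OF Q sub] by (simp add: Int_commute)
  \<comment> \<open>For \<open>x\<close> and \<open>y\<close> in \<open>Q\<close>, equality of the
    cosets on either side means that \<open>inv g \<otimes> inv x \<otimes> y \<otimes> g\<close>
    lies in \<open>Q\<close>.\<close>
  also have "\<dots> \<longleftrightarrow> finite (double_coset_lcosets G Q g)"
    unfolding double_coset_lcosets_def
    by (rule finite_image_cong_iff)
      (use g Qc Q sub in \<open>simp add: l_coset_eq_iff mem inv_mult_group m_assoc\<close>)
  finally show "finite_index G (conj_subgroup G g Q \<inter> Q) Q \<longleftrightarrow> finite (double_coset_lcosets G Q g)" .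
  \<comment> \<open>The coset of \<open>g \<otimes> q \<otimes> inv g\<close> is the translate by
    \<open>g\<close> of the coset of \<open>q \<otimes> inv g\<close>.\<close>
  have "(\<lambda>h. h <# Q) ` conj_subgroup G g Q = (\<lambda>C. g <# C) ` double_coset_lcosets G Q (inv g)"
    unfolding conj double_coset_lcosets_def image_image
    using g Qc Q by (intro image_cong refl) (simp add: lcos_m_assoc subgroup.subset m_assoc)
  moreover have "double_coset_lcosets G Q (inv g) \<subseteq> Pow (carrier G)"
    using g Q by (simp add: double_coset_lcosets_subset)
  ultimately have "finite ((\<lambda>h. h <# Q) ` conj_subgroup G g Q) \<longleftrightarrow>
      finite (double_coset_lcosets G Q (inv g))"
    using inj_on_l_coset[OF g] by (metis finite_image_iff inj_on_subset)
  then show "finite_index G (conj_subgroup G g Q \<inter> Q) (conj_subgroup G g Q) \<longleftrightarrow>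
      finite (double_coset_lcosets G Q (inv g))"
    using finite_index_Int_iff[OF sub Q] by simp
qed

lemma quasi_normal_iff_finite_double_coset:
  assumes "subgroup Q G"
  shows "quasi_normal G Q \<longleftrightarrow> (\<forall>a\<in>carrier G. finite (double_coset_lcosets G Q a))"
  using finite_index_conj_subgroup_iff[OF assms]
  unfolding quasi_normal_def commensurator_def by auto

section \<open>Arcs at a vertex and local finiteness\<close>

text \<open>The Cayley edges labeled \<open>s\<close> that start in \<open>g <# Q\<close> end at the
  elements \<open>g \<otimes> q \<otimes> s\<close>, whose cosets are the translates by
  \<open>g\<close> of those in Q s Q.\<close>

lemma out_arcs_left_coset_graph:
  assumes S: "S \<subseteq> carrier G" and Q: "subgroup Q G" and g: "g \<in> carrier G"
  shows "out_arcs (left_coset_graph G S Q) (g <# Q) =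
    (\<Union>s\<in>S. (\<lambda>v. (g <# Q, s, g <# v)) ` double_coset_lcosets G Q s)"
proof -
  note car = subgroup.mem_carrier[OF Q] subgroup.subset[OF Q] subsetD[OF S]
  have "(u, s, v) \<in> out_arcs (left_coset_graph G S Q) (g <# Q) \<longleftrightarrow>
      u = g <# Q \<and> s \<in> S \<and> v \<in> (\<lambda>v. g <# v) ` double_coset_lcosets G Q s" for u s v
  proof -
    have "(u, s, v) \<in> out_arcs (left_coset_graph G S Q) (g <# Q) \<longleftrightarrow>
        u = g <# Q \<and> (u, s, v) \<in> arcs (left_coset_graph G S Q)"
      by (auto simp: out_arcs_def tail_left_coset_graph)
    also have "\<dots> \<longleftrightarrow> u = g <# Q \<and> s \<in> S \<and> (\<exists>a\<in>g <# Q. v \<in> lcosets Q \<and> a \<otimes> s \<in> v)"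
      unfolding arcs_left_coset_graph_iff[OF group_axioms S Q] using g by (auto simp: LCOSETS_def)
    also have "\<dots> \<longleftrightarrow> u = g <# Q \<and> s \<in> S \<and> (\<exists>q\<in>Q. v \<in> lcosets Q \<and> g \<otimes> q \<otimes> s \<in> v)"
      unfolding l_coset_def[of G g Q] by simp
    also have "\<dots> \<longleftrightarrow> u = g <# Q \<and> s \<in> S \<and> (\<exists>q\<in>Q. v = (g \<otimes> q \<otimes> s) <# Q)"
      using g car lcosets_mem_iff[OF Q] by (metis m_closed)
    also have "\<dots> \<longleftrightarrow> u = g <# Q \<and> s \<in> S \<and> (\<exists>q\<in>Q. v = g <# ((q \<otimes> s) <# Q))"
      using g by (simp add: lcos_m_assoc m_assoc car cong: conj_cong)
    finally show ?thesis by (auto simp: double_coset_lcosets_def)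
  qed
  then show ?thesis by (intro Set.set_eqI, rename_tac e, case_tac e) auto
qed

lemma in_arcs_left_coset_graph:
  assumes S: "S \<subseteq> carrier G" and Q: "subgroup Q G" and f: "f \<in> carrier G"
  shows "in_arcs (left_coset_graph G S Q) (f <# Q) =
    (\<Union>s\<in>S. (\<lambda>u. (f <# u, s, f <# Q)) ` double_coset_lcosets G Q (inv s))"
proof -
  note car = subgroup.mem_carrier[OF Q] subgroup.subset[OF Q] subsetD[OF S]
  have "(u, s, v) \<in> in_arcs (left_coset_graph G S Q) (f <# Q) \<longleftrightarrow>
      v = f <# Q \<and> s \<in> S \<and> u \<in> (\<lambda>u. f <# u) ` double_coset_lcosets G Q (inv s)" for u s v
  proof -
    have "(u, s, v) \<in> in_arcs (left_coset_graph G S Q) (f <# Q) \<longleftrightarrow>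
        v = f <# Q \<and> (u, s, v) \<in> arcs (left_coset_graph G S Q)"
      by (auto simp: in_arcs_def head_left_coset_graph)
    also have "\<dots> \<longleftrightarrow> v = f <# Q \<and> s \<in> S \<and> u \<in> lcosets Q \<and> (\<exists>a\<in>u. a \<otimes> s \<in> f <# Q)"
      unfolding arcs_left_coset_graph_iff[OF group_axioms S Q] using f by (auto simp: LCOSETS_def)
    \<comment> \<open>Solving \<open>a \<otimes> s = f \<otimes> q\<close> for the initial point
      \<open>a\<close> brings in the inverse of the label.\<close>
    also have "\<dots> \<longleftrightarrow> v = f <# Q \<and> s \<in> S \<and> u \<in> lcosets Q \<and> (\<exists>q\<in>Q. f \<otimes> q \<otimes> inv s \<in> u)"
    proof -
      have "(\<exists>a\<in>u. a \<otimes> s \<in> f <# Q) \<longleftrightarrow> (\<exists>q\<in>Q. f \<otimes> q \<otimes> inv s \<in> u)"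
        if s: "s \<in> S" and u: "u \<in> lcosets Q"
      proof -
        have "u \<subseteq> carrier G" using u l_coset_subset_G[OF car(2)] by (force simp: LCOSETS_def)
        then have "a \<otimes> s = f \<otimes> q \<longleftrightarrow> a = f \<otimes> q \<otimes> inv s" if "a \<in> u" "q \<in> Q" for a q
          using that s f car(1,3) by (metis inv_solve_right m_closed subsetD)
        moreover have "f \<otimes> q \<otimes> inv s \<otimes> s = f \<otimes> q" if "q \<in> Q" for q
          using that s f by (simp add: m_assoc car)
        ultimately show ?thesis unfolding l_coset_def by simp blast
      qed
      then show ?thesis by blast
    qed
    also have "\<dots> \<longleftrightarrow> v = f <# Q \<and> s \<in> S \<and> (\<exists>q\<in>Q. u = (f \<otimes> q \<otimes> inv s) <# Q)"
      using f car lcosets_mem_iff[OF Q] by (metis m_closed inv_closed)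
    also have "\<dots> \<longleftrightarrow> v = f <# Q \<and> s \<in> S \<and> (\<exists>q\<in>Q. u = f <# ((q \<otimes> inv s) <# Q))"
      using f by (simp add: lcos_m_assoc m_assoc car cong: conj_cong)
    finally show ?thesis by (auto simp: double_coset_lcosets_def)
  qed
  then show ?thesis by (intro Set.set_eqI, rename_tac e, case_tac e) auto
qed

text \<open>The arcs leaving or entering a vertex form a union over the finite set \<open>S\<close>
  of injective images of double coset families, which do not depend on the vertex.\<close>

lemma locally_finite_left_coset_graph_iff:
  assumes S: "S \<subseteq> carrier G" "finite S" and Q: "subgroup Q G"
  shows "locally_finite (left_coset_graph G S Q) \<longleftrightarrow>
    (\<forall>s\<in>S. finite (double_coset_lcosets G Q s) \<and> finite (double_coset_lcosets G Q (inv s)))"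
proof -
  have inj: "inj_on (\<lambda>C. g <# C) (double_coset_lcosets G Q a)"
    if "g \<in> carrier G" "a \<in> carrier G" for g a
    using inj_on_subset[OF inj_on_l_coset double_coset_lcosets_subset] that Q by blast
  have "finite (out_arcs (left_coset_graph G S Q) (g <# Q)) \<longleftrightarrow>
      (\<forall>s\<in>S. finite (double_coset_lcosets G Q s))" if g: "g \<in> carrier G" for g
  proof -
    have "inj_on (\<lambda>v. (g <# Q, s, g <# v)) (double_coset_lcosets G Q s)" if "s \<in> S" for s
      using inj[OF g, of s] S that by (auto simp: inj_on_def)
    then show ?thesis using S g Q by (simp add: out_arcs_left_coset_graph finite_image_iff)
  qed
  moreover have "finite (in_arcs (left_coset_graph G S Q) (f <# Q)) \<longleftrightarrow>
      (\<forall>s\<in>S. finite (double_coset_lcosets G Q (inv s)))" if f: "f \<in> carrier G" for f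
  proof -
    have "inj_on (\<lambda>u. (f <# u, s, f <# Q)) (double_coset_lcosets G Q (inv s))" if "s \<in> S" for s
      using inj[OF f, of "inv s"] S that by (auto simp: inj_on_def)
    then show ?thesis using S f Q by (simp add: in_arcs_left_coset_graph finite_image_iff)
  qed
  moreover have "verts (left_coset_graph G S Q) = (\<lambda>g. g <# Q) ` carrier G"
    by (auto simp: left_coset_graph_def LCOSETS_def)
  \<comment> \<open>The identity supplies a vertex, at which the conditions on the labels are read
    off.\<close>
  ultimately show ?thesis unfolding locally_finite_def by (auto intro: one_closed)
qed

end

theorem theorem25:
  fixes G :: "('a, 'b) monoid_scheme" and S Q :: "'a set"
  assumes "group G"
    and "S \<subseteq> carrier G" and "finite S" and "generate G S = carrier G"
    and "subgroup Q G"
  shows "quasi_normal G Q \<longleftrightarrow> locally_finite (left_coset_graph G S Q)"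
proof -
  interpret group G by fact
  \<comment> \<open>One direction specializes to the generators and their inverses; the other uses
    that \<open>S\<close> generates the whole group.\<close>
  have "(\<forall>a\<in>carrier G. finite (double_coset_lcosets G Q a)) \<longleftrightarrow>
      (\<forall>s\<in>S. finite (double_coset_lcosets G Q s) \<and> finite (double_coset_lcosets G Q (inv\<^bsub>G\<^esub> s)))"
    using finite_double_coset_generate[of Q S] assms by auto
  then show ?thesis
    using assms by (simp add: quasi_normal_iff_finite_double_coset locally_finite_left_coset_graph_iff)
qed

end
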